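(* Let $n\ge3$ and let $A=\{s_i:1\le i\le n\}\subseteq S$ with all sites in $A$ being neighbors of each other under $\partial$. Then a necessary and sufficient condition for the permutation property of the joint distribution $\Pi_{s_1,\dots,s_n}$ of $X_{s_1},\dots,X_{s_n}$ is that $$\hat y_{s_i}^{u_i}=\hat\pi_{s_i}(x_{s_i}^{u_i})-\pi_{s_i}(x_{s_i}^{u_i}),\qquad 1\le u_i\le d_i,\ 1\le i\le n,$$ is a solution $y=\hat y$ of the following system of linear equations in the variables $y_{s_i}^{u_i}$ (the linear equations of blockwise canonical form): for all triples of distinct integers $1\le i,j,k\le n$ and all $1\le u_i\le d_i$, $1\le u_j\le d_j$, $1\le u_k\le d_k$, $$\tilde z_{s_j}^{u_j}\,\tilde\rho_{s_j,s_k}\,y_{s_i}^{u_i}=\tilde z_{s_i}^{u_i}\,\tilde\rho_{s_i,s_k}\,y_{s_j}^{u_j},\qquad \tilde z_{s_k}^{u_k}\,\tilde\rho_{s_j,s_k}\,y_{s_i}^{u_i}=\tilde z_{s_i}^{u_i}\,\tilde\rho_{s_i,s_j}\,y_{s_k}^{u_k}.$$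
   Context: $(S,\partial)$ is a connected finite space of sites with a neighborhood system $\partial$ ($s\notin\partial(s)$; $s\in\partial(t)$ iff $t\in\partial(s)$; $t$ is a neighbor of $s$ if $t\in\partial(s)$). For each $s_i$, $\mathbf{X}_{s_i}=\{x_{s_i}^1,\dots,x_{s_i}^{d_i}\}$ is a set of $d_i$ distinct reals; $\pi_{s_i}$ is a strictly positive pmf on $\mathbf{X}_{s_i}$, and $\tilde\pi_{s_i},\hat\pi_{s_i}$ are two auxiliary pmfs on $\mathbf{X}_{s_i}$; $\mu_{\tilde\pi_{s_i}}$ and $\sigma^2_{\tilde\pi_{s_i}}>0$ are the mean and variance of $\tilde\pi_{s_i}$. $\beta_{s_i,s_j}=\beta_{s_j,s_i}$ ($i\neq j$) are real numbers (prescribed covariances). Put $$\tilde z_{s_i}^{u_i}=\frac{\tilde\pi_{s_i}(x_{s_i}^{u_i})(x_{s_i}^{u_i}-\mu_{\tilde\pi_{s_i}})}{\sigma_{\tilde\pi_{s_i}}},\qquad \tilde\rho_{s_i,s_j}=\frac{\beta_{s_i,s_j}}{\sigma_{\tilde\pi_{s_i}}\sigma_{\tilde\pi_{s_j}}}.$$ For every ordering $t_1,\dots,t_n$ of the sites of $A$, the joint pmf $\Pi_{t_1,\dots,t_n}$ of the field generated sequentially in this order is defined by $\Pi_{t_1}=\pi_{t_1}$ and, for $2\le i\le n$, $$\Pi_{t_1,\dots,t_i}(x_{t_1},\dots,x_{t_i})=\Pi_{t_1,\dots,t_{i-1}}(x_{t_1},\dots,x_{t_{i-1}})\,\pi_{t_i}(x_{t_i})+\frac{\tilde\pi_{t_i}(x_{t_i})(x_{t_i}-\mu_{\tilde\pi_{t_i}})}{\sigma^2_{\tilde\pi_{t_i}}}\sum_{j=1}^{i-1}\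 \prod_{k=1,k\ne j}^{i-1}\hat\pi_{t_k}(x_{t_k})\cdot\frac{\beta_{t_i,t_j}\tilde\pi_{t_j}(x_{t_j})(x_{t_j}-\mu_{\tilde\pi_{t_j}})}{\sigma^2_{\tilde\pi_{t_j}}};$$ these functions are assumed to be pmfs (regularity). The permutation property of the joint distribution means: for every pair of permutations $g,h$ of $\{1,\dots,n\}$ and all $x_{s_i}\in\mathbf{X}_{s_i}$ ($1\le i\le n$), $$\Pi_{s_{g(1)},\dots,s_{g(n)}}(x_{s_{g(1)}},\dots,x_{s_{g(n)}})=\Pi_{s_{h(1)},\dots,s_{h(n)}}(x_{s_{h(1)}},\dots,x_{s_{h(n)}}).$$ *)

theory Defs
  imports "HOL-Probability.Probability" "HOL-Combinatorics.Permutations"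
begin

definition neighborhood_system :: "'s set \<Rightarrow> ('s \<Rightarrow> 's set) \<Rightarrow> bool" where
  "neighborhood_system S nbhd \<longleftrightarrow>
     (\<forall>a\<in>S. nbhd a \<subseteq> S) \<and> (\<forall>a\<in>S. a \<notin> nbhd a) \<and>
     (\<forall>a\<in>S. \<forall>b\<in>S. a \<in> nbhd b \<longleftrightarrow> b \<in> nbhd a)"

definition connected_sites :: "'s set \<Rightarrow> ('s \<Rightarrow> 's set) \<Rightarrow> bool" where
  "connected_sites S nbhd \<longleftrightarrow>
     (\<forall>a\<in>S. \<forall>b\<in>S. (a, b) \<in> {(a, b). a \<in> S \<and> b \<in> nbhd a}\<^sup>*)"

(* The values at site a are listed as x a 1, ..., x a (d a). *)
definition states :: "('s \<Rightarrow> nat \<Rightarrow> real) \<Rightarrow> ('s \<Rightarrow> nat) \<Rightarrow> 's \<Rightarrow> real set" where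
  "states x d a = x a ` {1..d a}"

definition mean :: "real pmf \<Rightarrow> real" where
  "mean p = measure_pmf.expectation p (\<lambda>v. v)"

definition var :: "real pmf \<Rightarrow> real" where
  "var p = measure_pmf.variance p (\<lambda>v. v)"

definition sd :: "real pmf \<Rightarrow> real" where
  "sd p = sqrt (var p)"

definition z_tilde :: "real pmf \<Rightarrow> real \<Rightarrow> real" where
  "z_tilde p v = pmf p v * (v - mean p) / sd p"

definition rho_tilde :: "('s \<Rightarrow> real pmf) \<Rightarrow> ('s \<Rightarrow> 's \<Rightarrow> real) \<Rightarrow> 's \<Rightarrow> 's \<Rightarrow> real" where
  "rho_tilde \<pi>t \<beta> a b = \<beta> a b / (sd (\<pi>t a) * sd (\<pi>t b))"

(* joint \<pi> \<pi>t \<pi>h \<beta> t m v is the joint function of the first m sites t 1, ..., t m of the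
   generating order t, evaluated at the tuple (v 1, ..., v m), where v k is the value at t k;
   \<pi>t and \<pi>h are the auxiliary families written with a tilde and a hat.
   Starting from 1 at m = 0, the recursion yields the single-site pmf of t 1 at m = 1. *)
primrec joint :: "('s \<Rightarrow> real pmf) \<Rightarrow> ('s \<Rightarrow> real pmf) \<Rightarrow> ('s \<Rightarrow> real pmf) \<Rightarrow>
    ('s \<Rightarrow> 's \<Rightarrow> real) \<Rightarrow> (nat \<Rightarrow> 's) \<Rightarrow> nat \<Rightarrow> (nat \<Rightarrow> real) \<Rightarrow> real" where
  "joint \<pi> \<pi>t \<pi>h \<beta> t 0 v = 1"
| "joint \<pi> \<pi>t \<pi>h \<beta> t (Suc m) v =
     joint \<pi> \<pi>t \<pi>h \<beta> t m v * pmf (\<pi> (t (Suc m))) (v (Suc m)) +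
     pmf (\<pi>t (t (Suc m))) (v (Suc m)) * (v (Suc m) - mean (\<pi>t (t (Suc m)))) / var (\<pi>t (t (Suc m))) *
       (\<Sum>j\<in>{1..m}. (\<Prod>k\<in>{1..m} - {j}. pmf (\<pi>h (t k)) (v k)) *
          (\<beta> (t (Suc m)) (t j) * pmf (\<pi>t (t j)) (v j) * (v j - mean (\<pi>t (t j))) / var (\<pi>t (t j))))"

definition is_pmf_on :: "'a set \<Rightarrow> ('a \<Rightarrow> real) \<Rightarrow> bool" where
  "is_pmf_on \<Omega> f \<longleftrightarrow> (\<exists>p. set_pmf p \<subseteq> \<Omega> \<and> (\<forall>\<omega>\<in>\<Omega>. pmf p \<omega> = f \<omega>))"

(* Regularity covers every ordering t of A and all partial joint functions along t. *)
definition regular :: "('s \<Rightarrow> nat \<Rightarrow> real) \<Rightarrow> ('s \<Rightarrow> nat) \<Rightarrow> ('s \<Rightarrow> real pmf) \<Rightarrow> ('s \<Rightarrow> real pmf) \<Rightarrow>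
    ('s \<Rightarrow> real pmf) \<Rightarrow> ('s \<Rightarrow> 's \<Rightarrow> real) \<Rightarrow> nat \<Rightarrow> 's set \<Rightarrow> bool" where
  "regular x d \<pi> \<pi>t \<pi>h \<beta> n A \<longleftrightarrow>
     (\<forall>t. bij_betw t {1..n} A \<longrightarrow>
        (\<forall>m\<in>{1..n}. is_pmf_on (PiE {1..m} (\<lambda>k. states x d (t k))) (joint \<pi> \<pi>t \<pi>h \<beta> t m)))"

(* v i is the value at site s i, so in the order s (g 1), ..., s (g n) the tuple of values
   is v (g 1), ..., v (g n). *)
definition permutation_property :: "('s \<Rightarrow> nat \<Rightarrow> real) \<Rightarrow> ('s \<Rightarrow> nat) \<Rightarrow> ('s \<Rightarrow> real pmf) \<Rightarrow>
    ('s \<Rightarrow> real pmf) \<Rightarrow> ('s \<Rightarrow> real pmf) \<Rightarrow> ('s \<Rightarrow> 's \<Rightarrow> real) \<Rightarrow> nat \<Rightarrow> (nat \<Rightarrow> 's) \<Rightarrow> bool" where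
  "permutation_property x d \<pi> \<pi>t \<pi>h \<beta> n s \<longleftrightarrow>
     (\<forall>g h. g permutes {1..n} \<longrightarrow> h permutes {1..n} \<longrightarrow>
        (\<forall>v. (\<forall>i\<in>{1..n}. v i \<in> states x d (s i)) \<longrightarrow>
           joint \<pi> \<pi>t \<pi>h \<beta> (s \<circ> g) n (v \<circ> g) = joint \<pi> \<pi>t \<pi>h \<beta> (s \<circ> h) n (v \<circ> h)))"

definition solves_blockwise_canonical :: "('s \<Rightarrow> nat \<Rightarrow> real) \<Rightarrow> ('s \<Rightarrow> nat) \<Rightarrow> ('s \<Rightarrow> real pmf) \<Rightarrow>
    ('s \<Rightarrow> 's \<Rightarrow> real) \<Rightarrow> nat \<Rightarrow> (nat \<Rightarrow> 's) \<Rightarrow> ('s \<Rightarrow> nat \<Rightarrow> real) \<Rightarrow> bool" where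
  "solves_blockwise_canonical x d \<pi>t \<beta> n s y \<longleftrightarrow>
     (\<forall>i\<in>{1..n}. \<forall>j\<in>{1..n}. \<forall>k\<in>{1..n}. i \<noteq> j \<longrightarrow> i \<noteq> k \<longrightarrow> j \<noteq> k \<longrightarrow>
        (\<forall>ui\<in>{1..d (s i)}. \<forall>uj\<in>{1..d (s j)}. \<forall>uk\<in>{1..d (s k)}.
           z_tilde (\<pi>t (s j)) (x (s j) uj) * rho_tilde \<pi>t \<beta> (s j) (s k) * y (s i) ui =
           z_tilde (\<pi>t (s i)) (x (s i) ui) * rho_tilde \<pi>t \<beta> (s i) (s k) * y (s j) uj \<and>
           z_tilde (\<pi>t (s k)) (x (s k) uk) * rho_tilde \<pi>t \<beta> (s j) (s k) * y (s i) ui =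
           z_tilde (\<pi>t (s i)) (x (s i) ui) * rho_tilde \<pi>t \<beta> (s i) (s j) * y (s k) uk))"

end

theory Submission
  imports Defs
begin

text \<open>
  Fix the values and write \<open>p\<^sub>a\<close>, \<open>h\<^sub>a\<close> for the two probabilities at site \<open>a\<close>,
  \<open>w\<^sub>a\<close> for \<open>\<sigma>\<^sub>a\<^sup>-\<^sup>2 \<pi>t\<^sub>a(v\<^sub>a) (v\<^sub>a - \<mu>\<^sub>a)\<close> and \<open>y\<^sub>a = h\<^sub>a - p\<^sub>a\<close>. Exchanging the two sites
  \<open>a\<close>, \<open>b\<close> generated last, after those of a set \<open>Z\<close>, changes the joint function by
  \<open>\<Sum>j\<in>Z. w\<^sub>j (\<Prod>k\<in>Z - {j}. h\<^sub>k) (w\<^sub>a \<beta>\<^sub>a\<^sub>j y\<^sub>b - w\<^sub>b \<beta>\<^sub>b\<^sub>j y\<^sub>a)\<close>.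
  Up to positive factors, the linear system says that every bracket vanishes, so it makes adjacent
  exchanges, hence all permutations, harmless. Conversely, exchange the second and third sites:
  all later steps add the same terms and multiply by positive \<open>p\<close>'s, so the exchange already leaves
  the three-site joint function unchanged. There \<open>Z\<close> is a single site \<open>j\<close>, and since its auxiliary
  variance is positive it has a value with \<open>w\<^sub>j \<noteq> 0\<close>; hence the bracket vanishes.
\<close>

text \<open>The list holds the sites in reverse order of generation.\<close>

primrec list_joint :: "('a \<Rightarrow> real) \<Rightarrow> ('a \<Rightarrow> real) \<Rightarrow> ('a \<Rightarrow> real) \<Rightarrow> ('a \<Rightarrow> 'a \<Rightarrow> real) \<Rightarrow>
    'a list \<Rightarrow> real" where
  "list_joint p h w b [] = 1"
| "list_joint p h w b (a # xs) = list_joint p h w b xs * p a +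
     w a * (\<Sum>j\<in>set xs. b a j * w j * (\<Prod>k\<in>set xs - {j}. h k))"

section \<open>Exchanging and reordering sites in the generating list\<close>

text \<open>The product of the two \<open>p\<close>'s and, by \<open>sym\<close>, the term coupling
  \<open>a\<close> with \<open>c\<close> are common to both orders. An earlier site \<open>j\<close>
  is coupled to the next-to-last site with a factor \<open>p\<close> of the last one, but to the
  last site with a factor \<open>h\<close> of the next-to-last; this mismatch leaves the differences
  \<open>h - p\<close>.\<close>

lemma list_joint_swap:
  assumes "distinct (a # c # xs)" and sym: "b a c = b c a"
  shows "list_joint p h w b (a # c # xs) - list_joint p h w b (c # a # xs) =
    (\<Sum>j\<in>set xs. w j * (\<Prod>k\<in>set xs - {j}. h k) *
       (w a * b a j * (h c - p c) - w c * b c j * (h a - p a)))"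
proof -
  define H where "H j = (\<Prod>k\<in>set xs - {j}. h k)" for j
  define T where "T e = (\<Sum>j\<in>set xs. b e j * w j * H j)" for e
  have expand: "list_joint p h w b (e # f # xs) =
      list_joint p h w b xs * p f * p e + w f * p e * T f
      + w e * (b e f * w f * (\<Prod>k\<in>set xs. h k) + h f * T e)"
    if "e \<notin> set xs" "f \<notin> set xs" for e f
  proof -
    have "(\<Prod>k\<in>insert f (set xs) - {j}. h k) = h f * H j" if "j \<in> set xs" for j
    proof -
      have "insert f (set xs) - {j} = insert f (set xs - {j})"
        using that \<open>f \<notin> set xs\<close> by auto
      then show ?thesis
        using \<open>f \<notin> set xs\<close> by (simp add: H_def)
    qed
    then have "(\<Sum>j\<in>set xs. b e j * w j * (\<Prod>k\<in>insert f (set xs) - {j}. h k)) = h f * T e"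
      by (simp add: T_def sum_distrib_left mult_ac)
    moreover have "insert f (set xs) - {f} = set xs"
      using \<open>f \<notin> set xs\<close> by auto
    ultimately show ?thesis
      using \<open>f \<notin> set xs\<close> by (simp add: T_def H_def algebra_simps)
  qed
  have "(\<Sum>j\<in>set xs. w j * H j * (w a * b a j * (h c - p c) - w c * b c j * (h a - p a)))
      = w a * (h c - p c) * T a - w c * (h a - p a) * T c"
    by (simp add: T_def sum_distrib_left sum_subtractf [symmetric] algebra_simps)
  moreover have notin: "a \<notin> set xs" "c \<notin> set xs"
    using assms by auto
  ultimately show ?thesis
    unfolding H_def [symmetric] expand[OF notin] expand[OF notin(2,1)] sym
    by (simp add: algebra_simps)
qed

text \<open>Lists with different heads \<open>a\<close>, \<open>c\<close> are connected through
  \<open>a # c # zs\<close> and \<open>c # a # zs\<close>: \<open>bal\<close> makes the exchange in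
  the middle harmless, and the outer comparisons share their head and reduce to shorter
  lists.\<close>

lemma list_joint_eq_if_set_eq:
  assumes sym: "\<And>i j. i \<in> I \<Longrightarrow> j \<in> I \<Longrightarrow> i \<noteq> j \<Longrightarrow> b i j = b j i"
    and bal: "\<And>i j k. i \<in> I \<Longrightarrow> j \<in> I \<Longrightarrow> k \<in> I \<Longrightarrow> i \<noteq> j \<Longrightarrow> i \<noteq> k \<Longrightarrow> j \<noteq> k \<Longrightarrow>
        w i * b i k * (h j - p j) = w j * b j k * (h i - p i)"
    and "distinct xs" "distinct ys" "set xs = set ys" "set xs \<subseteq> I"
  shows "list_joint p h w b xs = list_joint p h w b ys"
  using assms(3-)
proof (induction "length xs" arbitrary: xs ys rule: less_induct)
  case less
  show ?case
  proof (cases xs)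
    case Nil
    with less.prems show ?thesis by auto
  next
    case (Cons a xs')
    with less.prems obtain c ys' where ys: "ys = c # ys'"
      by (cases ys) auto
    \<comment> \<open>The term added by \<open>e\<close> sees the tail only through its set. The
      tails compared below, such as \<open>c # zs\<close>, need not be tails of \<open>xs\<close> or
      \<open>ys\<close>, hence the induction on length.\<close>
    have same_head: "list_joint p h w b (e # us) = list_joint p h w b (e # us')"
      if "distinct (e # us)" "distinct (e # us')" "set (e # us) = set xs" "set us = set us'"
      for e us us'
    proof -
      have "length us < length xs"
        using that distinct_card[of "e # us"] distinct_card[of xs] less.prems(1) by simp
      then have "list_joint p h w b us = list_joint p h w b us'"
        using that less.prems(4) by (intro less.hyps) auto
      with that show ?thesis by simp
    qed
    show ?thesis
    proof (cases "a = c")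
      case True
      have "set xs' = set ys'"
        using less.prems Cons ys True by auto
      then show ?thesis
        using same_head[of c xs' ys'] less.prems Cons ys True by simp
    next
      case False
      obtain zs where zs: "set zs = set xs - {a, c}" "distinct zs"
        using finite_distinct_list[of "set xs - {a, c}"] by auto
      have in_I: "a \<in> I" "c \<in> I" "set zs \<subseteq> I"
        using less.prems Cons ys zs by auto
      have "list_joint p h w b xs = list_joint p h w b (a # c # zs)"
        unfolding Cons by (rule same_head) (use less.prems Cons ys zs False in auto)
      also have "\<dots> = list_joint p h w b (c # a # zs)"
      proof -
        have "(\<Sum>j\<in>set zs. w j * (\<Prod>k\<in>set zs - {j}. h k) *
            (w a * b a j * (h c - p c) - w c * b c j * (h a - p a))) = 0"
          using in_I zs False bal[of a c] by (intro sum.neutral) auto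
        then show ?thesis
          using list_joint_swap[of a c zs b p h w] zs False sym[OF in_I(1,2)] by simp
      qed
      also have "\<dots> = list_joint p h w b ys"
        unfolding ys by (rule same_head) (use less.prems Cons ys zs False in auto)
      finally show ?thesis .
    qed
  qed
qed

text \<open>Each later site adds a term depending only on the set of its predecessors and multiplies
  by a nonzero \<open>p a\<close>; both can be undone one site at a time.\<close>

lemma list_joint_append_cancel:
  assumes "list_joint p h w b (us @ xs) = list_joint p h w b (us @ ys)"
    and "set xs = set ys" and "\<And>a. a \<in> set us \<Longrightarrow> p a \<noteq> 0"
  shows "list_joint p h w b xs = list_joint p h w b ys"
  using assms by (induction us) auto

section \<open>From orderings of positions to lists of indices\<close>

text \<open>The factor that the recursion attaches to a site; it divides by the variance where
  \<open>z_tilde\<close> divides by the standard deviation.\<close>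

definition normalized_dev :: "real pmf \<Rightarrow> real \<Rightarrow> real" where
  "normalized_dev q r = pmf q r * (r - mean q) / var q"

text \<open>Injectivity of \<open>g\<close> turns sums and products over positions into ones over
  indices. For a fixed \<open>v\<close>, all orderings then share the same weights and differ only
  in the list.\<close>

lemma joint_eq_list_joint:
  assumes "inj_on g {1..m}"
  shows "joint \<pi> \<pi>t \<pi>h \<beta> (s \<circ> g) m (v \<circ> g) =
    list_joint (\<lambda>i. pmf (\<pi> (s i)) (v i)) (\<lambda>i. pmf (\<pi>h (s i)) (v i))
      (\<lambda>i. normalized_dev (\<pi>t (s i)) (v i)) (\<lambda>i j. \<beta> (s i) (s j)) (rev (map g [1..<Suc m]))"
  using assms
proof (induction m)
  case 0
  then show ?case by simp
next
  case (Suc m)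
  have inj: "inj_on g {1..m}"
    using Suc.prems by (rule inj_on_subset) auto
  have set_eq: "set (rev (map g [1..<Suc m])) = g ` {1..m}"
    by (simp only: set_rev set_map set_upt atLeastLessThanSuc_atLeastAtMost)
  have prod_eq: "(\<Prod>k\<in>g ` {1..m} - {g j}. pmf (\<pi>h (s k)) (v k)) =
      (\<Prod>k\<in>{1..m} - {j}. pmf (\<pi>h (s (g k))) (v (g k)))" if "j \<in> {1..m}" for j
  proof -
    have "g ` {1..m} - {g j} = g ` ({1..m} - {j})"
      using inj_on_image_set_diff[OF inj, of "{1..m}" "{j}"] that
      by (simp only: image_insert image_empty) blast
    moreover have "inj_on g ({1..m} - {j})"
      using inj by (rule inj_on_subset) (rule Diff_subset)
    ultimately show ?thesis
      by (simp add: prod.reindex)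
  qed
  have upt: "rev (map g [1..<Suc (Suc m)]) = g (Suc m) # rev (map g [1..<Suc m])"
    by simp
  have "(\<Sum>i\<in>g ` {1..m}. \<beta> (s (g (Suc m))) (s i) * normalized_dev (\<pi>t (s i)) (v i) *
        (\<Prod>k\<in>g ` {1..m} - {i}. pmf (\<pi>h (s k)) (v k))) =
      (\<Sum>j\<in>{1..m}. (\<Prod>k\<in>{1..m} - {j}. pmf (\<pi>h (s (g k))) (v (g k))) *
        (\<beta> (s (g (Suc m))) (s (g j)) * pmf (\<pi>t (s (g j))) (v (g j)) *
          (v (g j) - mean (\<pi>t (s (g j)))) / var (\<pi>t (s (g j)))))"
    unfolding sum.reindex[OF inj] comp_def
    by (rule sum.cong) (simp_all only: prod_eq normalized_dev_def mult_ac times_divide_eq_right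
        times_divide_eq_left)
  then show ?case
    unfolding upt list_joint.simps joint.simps set_eq Suc.IH[OF inj, symmetric] comp_def
    by (simp only: normalized_dev_def)
qed

text \<open>Lets the converse direction prescribe which sites are generated first.\<close>

lemma ex_permutes_of_list:
  assumes "distinct xs" and "set xs = {1..n}"
  obtains g where "g permutes {1..n}" and "rev (map g [1..<Suc n]) = xs"
proof -
  have len: "length xs = n"
    using distinct_card[OF assms(1)] assms(2) by simp
  \<comment> \<open>Positions start at 1 and list indices at 0; outside \<open>{1..n}\<close> a
    permutation of that set must be the identity.\<close>
  define g where "g i = (if i \<in> {1..n} then rev xs ! (i - 1) else i)" for i
  have "map g [1..<Suc n] = rev xs"
    by (rule nth_equalityI) (auto simp: len g_def simp del: upt_Suc)
  then have rev_map: "rev (map g [1..<Suc n]) = xs"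
    by simp
  have "g ` {1..n} = {1..n}"
    using assms(2) unfolding rev_map [symmetric]
    by (simp only: set_rev set_map set_upt atLeastLessThanSuc_atLeastAtMost)
  moreover from this have "inj_on g {1..n}"
    by (intro eq_card_imp_inj_on) auto
  ultimately have "g permutes {1..n}"
    by (intro bij_imp_permutes) (auto simp: bij_betw_def g_def)
  then show ?thesis
    using rev_map that by blast
qed

section \<open>Nonzero deviations and rescaling of the linear equations\<close>

text \<open>Otherwise \<open>q\<close> would be concentrated at its mean and have variance
  zero.\<close>

lemma normalized_dev_nonzero:
  assumes "var q > 0"
  obtains r where "r \<in> set_pmf q" and "normalized_dev q r \<noteq> 0"
proof -
  have "\<exists>r\<in>set_pmf q. r \<noteq> mean q"
  proof (rule ccontr)
    assume "\<not> ?thesis"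
    then have "AE r in measure_pmf q. (r - mean q)\<^sup>2 = 0"
      by (auto simp: AE_measure_pmf_iff)
    then have "var q = 0"
      unfolding var_def mean_def [symmetric] by (rule integral_eq_zero_AE)
    with assms show False by simp
  qed
  then show ?thesis
    using that assms by (auto simp: normalized_dev_def set_pmf_iff)
qed

lemma sd_pos: "var q > 0 \<Longrightarrow> sd q > 0"
  by (simp add: sd_def)

lemma z_tilde_eq:
  assumes "var q > 0"
  shows "z_tilde q r = sd q * normalized_dev q r"
proof -
  have "var q = sd q * sd q"
    using assms by (simp add: sd_def)
  then show ?thesis
    using sd_pos[OF assms] by (simp add: z_tilde_def normalized_dev_def)
qed

text \<open>In each product of \<open>z_tilde\<close> and \<open>rho_tilde\<close> the standard
  deviation of the site in \<open>z_tilde\<close> cancels, leaving the common factor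
  \<open>1 / sd (\<pi>t e)\<close> on both sides.\<close>

lemma canonical_equation_iff:
  assumes "var (\<pi>t a) > 0" "var (\<pi>t c) > 0" "var (\<pi>t e) > 0"
  shows "z_tilde (\<pi>t c) r * rho_tilde \<pi>t \<beta> c e * y = z_tilde (\<pi>t a) q * rho_tilde \<pi>t \<beta> a e * y' \<longleftrightarrow>
    normalized_dev (\<pi>t c) r * \<beta> c e * y = normalized_dev (\<pi>t a) q * \<beta> a e * y'"
  using sd_pos[OF assms(1)] sd_pos[OF assms(2)] sd_pos[OF assms(3)]
  by (simp add: z_tilde_eq assms rho_tilde_def)

section \<open>Permutation property and the blockwise canonical system\<close>

theorem proposition5p2:
  fixes S A :: "'s set"
    and nbhd :: "'s \<Rightarrow> 's set"
    and n :: nat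
    and s :: "nat \<Rightarrow> 's"
    and x :: "'s \<Rightarrow> nat \<Rightarrow> real"
    and d :: "'s \<Rightarrow> nat"
    and \<pi> \<pi>t \<pi>h :: "'s \<Rightarrow> real pmf"
    and \<beta> :: "'s \<Rightarrow> 's \<Rightarrow> real"
  assumes "finite S"
    and "neighborhood_system S nbhd"
    and "connected_sites S nbhd"
    and "n \<ge> 3"
    and "inj_on s {1..n}" and "A = s ` {1..n}" and "A \<subseteq> S"
    and "\<And>a b. a \<in> A \<Longrightarrow> b \<in> A \<Longrightarrow> a \<noteq> b \<Longrightarrow> b \<in> nbhd a"
    and "\<And>a. a \<in> A \<Longrightarrow> inj_on (x a) {1..d a}"
    and "\<And>a. a \<in> A \<Longrightarrow> set_pmf (\<pi> a) = states x d a"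
    and "\<And>a. a \<in> A \<Longrightarrow> set_pmf (\<pi>t a) \<subseteq> states x d a"
    and "\<And>a. a \<in> A \<Longrightarrow> set_pmf (\<pi>h a) \<subseteq> states x d a"
    and "\<And>a. a \<in> A \<Longrightarrow> var (\<pi>t a) > 0"
    and "\<And>a b. a \<in> A \<Longrightarrow> b \<in> A \<Longrightarrow> a \<noteq> b \<Longrightarrow> \<beta> a b = \<beta> b a"
    and "regular x d \<pi> \<pi>t \<pi>h \<beta> n A"
  shows "permutation_property x d \<pi> \<pi>t \<pi>h \<beta> n s \<longleftrightarrow>
         solves_blockwise_canonical x d \<pi>t \<beta> n s
           (\<lambda>a u. pmf (\<pi>h a) (x a u) - pmf (\<pi> a) (x a u))"
proof -
  define w where "w i r = normalized_dev (\<pi>t (s i)) r" for i r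
  define L where "L v = list_joint (\<lambda>i. pmf (\<pi> (s i)) (v i)) (\<lambda>i. pmf (\<pi>h (s i)) (v i))
      (\<lambda>i. w i (v i)) (\<lambda>i j. \<beta> (s i) (s j))" for v
  define y where "y i r = pmf (\<pi>h (s i)) r - pmf (\<pi> (s i)) r" for i r
  \<comment> \<open>The first family of linear equations, rescaled and stated for values instead of
    their numbers.\<close>
  define balanced where "balanced \<longleftrightarrow>
    (\<forall>i\<in>{1..n}. \<forall>j\<in>{1..n}. \<forall>k\<in>{1..n}. i \<noteq> j \<longrightarrow> i \<noteq> k \<longrightarrow> j \<noteq> k \<longrightarrow>
      (\<forall>q\<in>states x d (s i). \<forall>r\<in>states x d (s j).
         w i q * \<beta> (s i) (s k) * y j r = w j r * \<beta> (s j) (s k) * y i q))"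
  have in_A: "s i \<in> A" if "i \<in> {1..n}" for i
    using that assms(6) by auto
  have s_neq: "s i \<noteq> s j" if "i \<in> {1..n}" "j \<in> {1..n}" "i \<noteq> j" for i j
    using that assms(5) by (simp add: inj_on_eq_iff)
  have \<beta>_sym: "\<beta> (s i) (s j) = \<beta> (s j) (s i)" if "i \<in> {1..n}" "j \<in> {1..n}" "i \<noteq> j" for i j
    using that by (intro assms(14) in_A s_neq)
  have var_pos: "var (\<pi>t (s i)) > 0" if "i \<in> {1..n}" for i
    using that by (intro assms(13) in_A)
  have joint_L: "joint \<pi> \<pi>t \<pi>h \<beta> (s \<circ> g) n (v \<circ> g) = L v (rev (map g [1..<Suc n]))"
    if "g permutes {1..n}" for g v
    unfolding L_def w_def using permutes_inj_on[OF that] by (rule joint_eq_list_joint)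

  have canonical: "solves_blockwise_canonical x d \<pi>t \<beta> n s
      (\<lambda>a u. pmf (\<pi>h a) (x a u) - pmf (\<pi> a) (x a u)) \<longleftrightarrow> balanced" (is "?solves \<longleftrightarrow> _")
  proof
    assume solves: ?solves
    show balanced
      unfolding balanced_def states_def
    proof (intro ballI impI, elim imageE, hypsubst)
      fix i j k ui uj
      assume ijk: "i \<in> {1..n}" "j \<in> {1..n}" "k \<in> {1..n}" "i \<noteq> j" "i \<noteq> k" "j \<noteq> k"
        and u: "ui \<in> {1..d (s i)}" "uj \<in> {1..d (s j)}"
      \<comment> \<open>The system quantifies over \<open>uk\<close> even in the equation without
        it, so some value at \<open>s k\<close> must be supplied.\<close>
      have "states x d (s k) \<noteq> {}"
        using assms(10)[OF in_A[OF ijk(3)]] set_pmf_not_empty by metis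
      then obtain uk where "uk \<in> {1..d (s k)}"
        by (auto simp: states_def)
      with solves ijk u
      have "z_tilde (\<pi>t (s j)) (x (s j) uj) * rho_tilde \<pi>t \<beta> (s j) (s k) * y i (x (s i) ui) =
            z_tilde (\<pi>t (s i)) (x (s i) ui) * rho_tilde \<pi>t \<beta> (s i) (s k) * y j (x (s j) uj)"
        unfolding solves_blockwise_canonical_def y_def by blast
      then show "w i (x (s i) ui) * \<beta> (s i) (s k) * y j (x (s j) uj) =
          w j (x (s j) uj) * \<beta> (s j) (s k) * y i (x (s i) ui)"
        using ijk var_pos by (simp add: canonical_equation_iff w_def)
    qed
  next
    assume bal: balanced
    have eq: "z_tilde (\<pi>t (s j)) (x (s j) uj) * rho_tilde \<pi>t \<beta> (s j) (s k) * y i (x (s i) ui) =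
          z_tilde (\<pi>t (s i)) (x (s i) ui) * rho_tilde \<pi>t \<beta> (s i) (s k) * y j (x (s j) uj)"
      if "i \<in> {1..n}" "j \<in> {1..n}" "k \<in> {1..n}" "i \<noteq> j" "i \<noteq> k" "j \<noteq> k"
        "ui \<in> {1..d (s i)}" "uj \<in> {1..d (s j)}" for i j k ui uj
    proof -
      have "w i (x (s i) ui) * \<beta> (s i) (s k) * y j (x (s j) uj) =
          w j (x (s j) uj) * \<beta> (s j) (s k) * y i (x (s i) ui)"
        using bal that unfolding balanced_def states_def by blast
      then show ?thesis
        using that var_pos by (simp add: canonical_equation_iff w_def)
    qed
    have rho_sym: "rho_tilde \<pi>t \<beta> (s k) (s j) = rho_tilde \<pi>t \<beta> (s j) (s k)"
      if "j \<in> {1..n}" "k \<in> {1..n}" "j \<noteq> k" for j k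
      using \<beta>_sym[OF that] by (simp add: rho_tilde_def mult.commute)
    show ?solves
      unfolding solves_blockwise_canonical_def y_def [symmetric]
    proof (intro ballI impI conjI)
      fix i j k ui uj uk
      assume ijk: "i \<in> {1..n}" "j \<in> {1..n}" "k \<in> {1..n}" "i \<noteq> j" "i \<noteq> k" "j \<noteq> k"
        and u: "ui \<in> {1..d (s i)}" "uj \<in> {1..d (s j)}" "uk \<in> {1..d (s k)}"
      show "z_tilde (\<pi>t (s j)) (x (s j) uj) * rho_tilde \<pi>t \<beta> (s j) (s k) * y i (x (s i) ui) =
          z_tilde (\<pi>t (s i)) (x (s i) ui) * rho_tilde \<pi>t \<beta> (s i) (s k) * y j (x (s j) uj)"
        using ijk u by (intro eq)
      \<comment> \<open>The second equation for \<open>(i, j, k)\<close> is the first one for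
        \<open>(i, k, j)\<close>, up to the symmetry of \<open>rho_tilde\<close>.\<close>
      have "z_tilde (\<pi>t (s k)) (x (s k) uk) * rho_tilde \<pi>t \<beta> (s k) (s j) * y i (x (s i) ui) =
          z_tilde (\<pi>t (s i)) (x (s i) ui) * rho_tilde \<pi>t \<beta> (s i) (s j) * y k (x (s k) uk)"
        using ijk u by (intro eq) simp_all
      then show "z_tilde (\<pi>t (s k)) (x (s k) uk) * rho_tilde \<pi>t \<beta> (s j) (s k) * y i (x (s i) ui) =
          z_tilde (\<pi>t (s i)) (x (s i) ui) * rho_tilde \<pi>t \<beta> (s i) (s j) * y k (x (s k) uk)"
        unfolding rho_sym[OF ijk(2,3,6)] .
    qed
  qed

  have "permutation_property x d \<pi> \<pi>t \<pi>h \<beta> n s \<longleftrightarrow> balanced"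
  proof
    assume bal: balanced
    show "permutation_property x d \<pi> \<pi>t \<pi>h \<beta> n s"
      unfolding permutation_property_def
    proof (intro allI impI)
      fix g h v
      assume perm: "g permutes {1..n}" "h permutes {1..n}"
        and v: "\<forall>i\<in>{1..n}. v i \<in> states x d (s i)"
      have set_eq: "set (rev (map f [1..<Suc n])) = {1..n}" "distinct (rev (map f [1..<Suc n]))"
        if "f permutes {1..n}" for f
        using permutes_image[OF that] permutes_inj_on[OF that]
        by (simp_all only: set_rev set_map set_upt atLeastLessThanSuc_atLeastAtMost
            distinct_rev distinct_map distinct_upt simp_thms)
      have "L v (rev (map g [1..<Suc n])) = L v (rev (map h [1..<Suc n]))"
        unfolding L_def
      proof (rule list_joint_eq_if_set_eq[where I = "{1..n}"])
        fix i j k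
        assume "i \<in> {1..n}" "j \<in> {1..n}" "k \<in> {1..n}" "i \<noteq> j" "i \<noteq> k" "j \<noteq> k"
        with bal v show "w i (v i) * \<beta> (s i) (s k) * (pmf (\<pi>h (s j)) (v j) - pmf (\<pi> (s j)) (v j)) =
            w j (v j) * \<beta> (s j) (s k) * (pmf (\<pi>h (s i)) (v i) - pmf (\<pi> (s i)) (v i))"
          unfolding balanced_def y_def by blast
      qed (simp_all only: set_eq perm \<beta>_sym order_refl)
      then show "joint \<pi> \<pi>t \<pi>h \<beta> (s \<circ> g) n (v \<circ> g) = joint \<pi> \<pi>t \<pi>h \<beta> (s \<circ> h) n (v \<circ> h)"
        by (simp only: joint_L perm)
    qed
  next
    assume perm: "permutation_property x d \<pi> \<pi>t \<pi>h \<beta> n s"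
    show balanced
      unfolding balanced_def
    proof (intro ballI impI)
      fix i j k q r
      assume ijk: "i \<in> {1..n}" "j \<in> {1..n}" "k \<in> {1..n}" "i \<noteq> j" "i \<noteq> k" "j \<noteq> k"
        and qr: "q \<in> states x d (s i)" "r \<in> states x d (s j)"
      \<comment> \<open>A value at \<open>s k\<close> whose nonzero weight can be cancelled at the
        end.\<close>
      obtain t where t: "t \<in> set_pmf (\<pi>t (s k))" "w k t \<noteq> 0"
        unfolding w_def using normalized_dev_nonzero[OF var_pos[OF ijk(3)]] .
      have "\<forall>l\<in>{1..n}. \<exists>e. e \<in> states x d (s l)"
        using assms(10) in_A set_pmf_not_empty by (metis ex_in_conv)
      then obtain e where e: "\<And>l. l \<in> {1..n} \<Longrightarrow> e l \<in> states x d (s l)"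
        by metis
      \<comment> \<open>The values \<open>e\<close> at the remaining sites are arbitrary, but must
        be states for the permutation property to apply.\<close>
      define v where "v = e(i := q, j := r, k := t)"
      have v: "v l \<in> states x d (s l)" if "l \<in> {1..n}" for l
        using that e qr t(1) assms(11)[OF in_A[OF ijk(3)]] by (auto simp: v_def)
      \<comment> \<open>Since lists are reversed, in \<open>us @ [i, j, k]\<close> the site
        \<open>k\<close> is generated first, then \<open>j\<close> and \<open>i\<close>, then those
        in \<open>us\<close>.\<close>
      obtain us where us: "set us = {1..n} - {i, j, k}" "distinct us"
        using finite_distinct_list[OF finite_Diff[OF finite_atLeastAtMost]] by metis
      have "distinct (us @ [i, j, k])"
        using us ijk(4-6) by simp
      moreover have "set (us @ [i, j, k]) = {1..n}"
        unfolding set_append us(1) list.set using ijk(1-3) by blast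
      ultimately obtain g where g: "g permutes {1..n}" "rev (map g [1..<Suc n]) = us @ [i, j, k]"
        by (rule ex_permutes_of_list)
      have "distinct (us @ [j, i, k])"
        using us ijk(4-6) by simp
      moreover have "set (us @ [j, i, k]) = {1..n}"
        unfolding set_append us(1) list.set using ijk(1-3) by blast
      ultimately obtain h where h: "h permutes {1..n}" "rev (map h [1..<Suc n]) = us @ [j, i, k]"
        by (rule ex_permutes_of_list)
      have "L v (us @ [i, j, k]) = L v (us @ [j, i, k])"
      proof -
        have "joint \<pi> \<pi>t \<pi>h \<beta> (s \<circ> g) n (v \<circ> g) = joint \<pi> \<pi>t \<pi>h \<beta> (s \<circ> h) n (v \<circ> h)"
          using perm v g(1) h(1) unfolding permutation_property_def by blast
        then show ?thesis
          unfolding joint_L[OF g(1)] joint_L[OF h(1)] g(2) h(2) .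
      qed
      then have "L v [i, j, k] = L v [j, i, k]"
        unfolding L_def
      proof (rule list_joint_append_cancel)
        \<comment> \<open>States are exactly the support of \<open>\<pi>\<close>, so the later
          factors are nonzero.\<close>
        fix a assume "a \<in> set us"
        then have "a \<in> {1..n}"
          using us by auto
        then show "pmf (\<pi> (s a)) (v a) \<noteq> 0"
          using v assms(10) in_A by (simp add: set_pmf_iff [symmetric])
      qed auto
      \<comment> \<open>Over the one-element list \<open>[k]\<close> the exchange formula has a
        single summand, with an empty product of \<open>h\<close>'s.\<close>
      then have "w k t * (w i q * \<beta> (s i) (s k) * y j r - w j r * \<beta> (s j) (s k) * y i q) = 0"
        using list_joint_swap[of i j "[k]" "\<lambda>i j. \<beta> (s i) (s j)" "\<lambda>i. pmf (\<pi> (s i)) (v i)"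
            "\<lambda>i. pmf (\<pi>h (s i)) (v i)" "\<lambda>i. w i (v i)"] ijk \<beta>_sym
        unfolding L_def by (simp add: v_def y_def)
      with t(2) show "w i q * \<beta> (s i) (s k) * y j r = w j r * \<beta> (s j) (s k) * y i q"
        by simp
    qed
  qed
  with canonical show ?thesis by simp
qed

end
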